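(* Let $G$ be a finite simple graph with no isolated vertices and $n=|V(G)|$ vertices. Then every $G$-CFF$(t,n)$ $\{B_v: v\in V(G)\}$ is a $1$-CFF$(t,n)$, i.e. $B_u\not\subseteq B_v$ for all distinct vertices $u,v$.
   Context: For a finite simple graph $G$, a $G$-CFF$(t,|V(G)|)$ is a family of subsets $B_v\subseteq[1,t]=\{1,\dots,t\}$, one for each vertex $v$, such that for every edge $\{a,b\}$ of $G$: (i) $B_a\not\subseteq B_b$ and $B_b\not\subseteq B_a$, and (ii) for every vertex $w\notin\{a,b\}$, $B_w\not\subseteq B_a\cup B_b$. *)

theory Defs
  imports "Graph_Theory.Digraph"
begin

text \<open>A finite simple graph is the library's \<^const>\<open>Digraph.graph\<close>: finite, loop-free, without parallel
  arcs, and symmetric. An undirected edge \<open>{a, b}\<close> is thus the pair of arcs in both directions, and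
  \<open>a \<rightarrow>\<^bsub>G\<^esub> b\<close> says that \<open>{a, b}\<close> is an edge.\<close>

definition isolated_vertex :: "('a, 'b) pre_digraph \<Rightarrow> 'a \<Rightarrow> bool" where
  "isolated_vertex G v \<longleftrightarrow> v \<in> verts G \<and> \<not> (\<exists>w \<in> verts G. v \<rightarrow>\<^bsub>G\<^esub> w)"

text \<open>\<open>graph_cff G t B\<close>: the family \<open>B\<close>, restricted to the vertices of \<open>G\<close>, is a
  \<open>G\<close>-CFF\<open>(t, |V(G)|)\<close>. The values of \<open>B\<close> outside \<open>verts G\<close> are irrelevant.\<close>

definition graph_cff :: "('a, 'b) pre_digraph \<Rightarrow> nat \<Rightarrow> ('a \<Rightarrow> nat set) \<Rightarrow> bool" where
  "graph_cff G t B \<longleftrightarrow>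
     (\<forall>v \<in> verts G. B v \<subseteq> {1..t}) \<and>
     (\<forall>a \<in> verts G. \<forall>b \<in> verts G. a \<rightarrow>\<^bsub>G\<^esub> b \<longrightarrow>
        \<not> B a \<subseteq> B b \<and> \<not> B b \<subseteq> B a \<and>
        (\<forall>w \<in> verts G. w \<notin> {a, b} \<longrightarrow> \<not> B w \<subseteq> B a \<union> B b))"

text \<open>\<open>one_cff t n V B\<close>: the family \<open>B\<close>, indexed by the \<open>n\<close>-element set \<open>V\<close>, is a \<open>1\<close>-CFF\<open>(t, n)\<close>.\<close>

definition one_cff :: "nat \<Rightarrow> nat \<Rightarrow> 'a set \<Rightarrow> ('a \<Rightarrow> nat set) \<Rightarrow> bool" where
  "one_cff t n V B \<longleftrightarrow>
     finite V \<and> card V = n \<and>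
     (\<forall>v \<in> V. B v \<subseteq> {1..t}) \<and>
     (\<forall>u \<in> V. \<forall>v \<in> V. u \<noteq> v \<longrightarrow> \<not> B u \<subseteq> B v)"

end

theory Submission
  imports Defs
begin

text \<open>Every vertex \<open>v\<close> lies on some edge, say with \<open>w\<close>. The edge
  condition then protects \<open>B v\<close> against every other vertex \<open>u\<close>: either
  \<open>u\<close> is the other end \<open>w\<close>, or \<open>u\<close> lies off the edge and
  \<open>B u\<close> is not even contained in the larger set
  \<open>B v \<union> B w\<close>.\<close>

theorem theorem4p9:
  fixes G :: "('a, 'b) pre_digraph" and n t :: nat and B :: "'a \<Rightarrow> nat set"
  assumes "Digraph.graph G"
    and "\<forall>v \<in> verts G. \<not> isolated_vertex G v"
    and "n = card (verts G)"
    and "graph_cff G t B"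
  shows "one_cff t n (verts G) B"
proof -
  interpret Digraph.graph G by (rule assms(1))
  have "\<not> B u \<subseteq> B v" if u: "u \<in> verts G" and v: "v \<in> verts G" and "u \<noteq> v" for u v
  proof -
    \<comment> \<open>The neighbour is chosen for \<open>v\<close>, the would-be superset, so that
      \<open>B v\<close> is part of the union over an edge.\<close>
    obtain w where w: "w \<in> verts G" "v \<rightarrow>\<^bsub>G\<^esub> w"
      using assms(2) v unfolding isolated_vertex_def by blast
    show ?thesis
    proof (cases "u = w")
      case True
      then show ?thesis
        \<comment> \<open>Here \<open>u\<close> and \<open>v\<close> are adjacent, so condition (i)
          applies.\<close>
        using assms(4) v w unfolding graph_cff_def by blast
    next
      case False
      \<comment> \<open>Now \<open>u\<close> avoids both ends of the edge, so condition (ii)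
        applies.\<close>
      with \<open>u \<noteq> v\<close> have "\<not> B u \<subseteq> B v \<union> B w"
        using assms(4) u v w unfolding graph_cff_def by blast
      then show ?thesis by blast
    qed
  qed
  then show ?thesis
    using assms(3,4) finite_verts unfolding one_cff_def graph_cff_def by blast
qed

end
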